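(* Let $\Delta$ be an infinite rank 2 root system of type $H(a,b)$ and let $\Gamma\subseteq\Delta^{\mathrm{re}}$ be a set of real roots which generates $\Delta$, that is, $\Delta(\Gamma)=\Delta$. Then either $\Phi(\Gamma)$ is the set of all real roots in $\Delta$, or it is the set of all short real roots in $\Delta$. The second case occurs only if $a=1$ or $b=1$ and $\Phi(\Gamma)$ consists of short roots. In particular, if $a=b$ then $\Delta^{\mathrm{re}}(\Gamma)=\Phi(\Gamma)$.
   Context: For integers $a\ge b\ge 1$ (assumed without loss of generality) with $ab\ge 4$, the infinite rank 2 root system $\Delta$ of type $H(a,b)$ is the root system of the Kac--Moody algebra with generalized Cartan matrix $\begin{pmatrix}2&-b\\-a&2\end{pmatrix}$. Simple roots are $\alpha_1,\alpha_2$; simple reflections $w_1(\alpha_1)=-\alpha_1$, $w_1(\alpha_2)=\alpha_2+b\alpha_1$, $w_2(\alpha_1)=\alpha_1+a\alpha_2$, $w_2(\alpha_2)=-\alpha_2$; $W=\langle w_1,w_2\rangle$; symmetric bilinear form $(\alpha_1,\alpha_1)=2a/b$, $(\alpha_1,\alpha_2)=-a$, $(\alpha_2,\alpha_2)=2$. Real roots: $\Delta^{\mathrm{re}}=W\alpha_1\cup W\alpha_2$. Imaginary roots: the nonzero $\alpha\in\mathbb Z\alpha_1+\mathbb Z\alpha_2$ with $(\alpha,\alpha)\le0$. $\Delta$ is the union of both. If $a>b$, the roots in $W\alpha_1$ are long and those in $W\alpha_2$ are short; if $a=b$ all real roots are considered long. For a real root $\alpha$, $w_\alpha$ denotes the reflection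 $w_\alpha(\beta)=\beta-\frac{2(\beta,\alpha)}{(\alpha,\alpha)}\alpha$. For $\Gamma\subseteq\Delta^{\mathrm{re}}$: $W_\Gamma=\langle w_\alpha:\alpha\in\Gamma\rangle$, $\Phi(\Gamma)=W_\Gamma\cdot\Gamma$, $\Delta(\Gamma)=\mathbb Z\Gamma\cap\Delta$, $\Delta^{\mathrm{re}}(\Gamma)=\mathbb Z\Gamma\cap\Delta^{\mathrm{re}}$, where $\mathbb Z\Gamma$ is the set of integer linear combinations of elements of $\Gamma$. *)

theory Defs
  imports "HOL-Analysis.Product_Vector" "HOL-Algebra.Bij" "HOL-Algebra.Generated_Groups"
begin

text \<open>
  The root lattice sits in the real vector space with basis \<open>\<alpha>\<^sub>1, \<alpha>\<^sub>2\<close>, represented by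
  coordinate pairs: \<open>(x, y)\<close> stands for \<open>x \<alpha>\<^sub>1 + y \<alpha>\<^sub>2\<close>. The root system of type
  \<open>H(a,b)\<close> depends on the integers \<open>a, b\<close>; the standing assumptions \<open>a \<ge> b \<ge> 1\<close> and
  \<open>a b \<ge> 4\<close> are made where the definitions are used.
\<close>

type_synonym vec = "real \<times> real"

definition alpha1 :: vec where "alpha1 = (1, 0)"

definition alpha2 :: vec where "alpha2 = (0, 1)"

definition root_lattice :: "vec set" where
  "root_lattice = {of_int m *\<^sub>R alpha1 + of_int n *\<^sub>R alpha2 | m n :: int. True}"

definition w1 :: "int \<Rightarrow> vec \<Rightarrow> vec" where
  "w1 b v = fst v *\<^sub>R (- alpha1) + snd v *\<^sub>R (alpha2 + of_int b *\<^sub>R alpha1)"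

definition w2 :: "int \<Rightarrow> vec \<Rightarrow> vec" where
  "w2 a v = fst v *\<^sub>R (alpha1 + of_int a *\<^sub>R alpha2) + snd v *\<^sub>R (- alpha2)"

text \<open>The symmetric bilinear form with \<open>(\<alpha>\<^sub>1,\<alpha>\<^sub>1) = 2a/b\<close>, \<open>(\<alpha>\<^sub>1,\<alpha>\<^sub>2) = -a\<close>,
  \<open>(\<alpha>\<^sub>2,\<alpha>\<^sub>2) = 2\<close>.\<close>

definition bform :: "int \<Rightarrow> int \<Rightarrow> vec \<Rightarrow> vec \<Rightarrow> real" where
  "bform a b u v =
     (2 * of_int a / of_int b) * (fst u * fst v)
     - of_int a * (fst u * snd v + snd u * fst v)
     + 2 * (snd u * snd v)"

definition weyl_group :: "int \<Rightarrow> int \<Rightarrow> (vec \<Rightarrow> vec) set" where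
  "weyl_group a b = generate (BijGroup UNIV) {w1 b, w2 a}"

definition weyl_orbit :: "int \<Rightarrow> int \<Rightarrow> vec \<Rightarrow> vec set" where
  "weyl_orbit a b v = {w v | w. w \<in> weyl_group a b}"

definition real_roots :: "int \<Rightarrow> int \<Rightarrow> vec set" where
  "real_roots a b = weyl_orbit a b alpha1 \<union> weyl_orbit a b alpha2"

definition imaginary_roots :: "int \<Rightarrow> int \<Rightarrow> vec set" where
  "imaginary_roots a b = {v \<in> root_lattice. v \<noteq> 0 \<and> bform a b v v \<le> 0}"

definition roots :: "int \<Rightarrow> int \<Rightarrow> vec set" where
  "roots a b = real_roots a b \<union> imaginary_roots a b"

text \<open>Convention (for \<open>a \<ge> b\<close>): if \<open>a = b\<close>, all real roots are long, so there are no short ones.\<close>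

definition short_roots :: "int \<Rightarrow> int \<Rightarrow> vec set" where
  "short_roots a b = (if a > b then weyl_orbit a b alpha2 else {})"

definition reflection :: "int \<Rightarrow> int \<Rightarrow> vec \<Rightarrow> vec \<Rightarrow> vec" where
  "reflection a b \<alpha> \<beta> = \<beta> - (2 * bform a b \<beta> \<alpha> / bform a b \<alpha> \<alpha>) *\<^sub>R \<alpha>"

definition reflection_group :: "int \<Rightarrow> int \<Rightarrow> vec set \<Rightarrow> (vec \<Rightarrow> vec) set" where
  "reflection_group a b \<Gamma> = generate (BijGroup UNIV) (reflection a b ` \<Gamma>)"

definition Phi :: "int \<Rightarrow> int \<Rightarrow> vec set \<Rightarrow> vec set" where
  "Phi a b \<Gamma> = {w \<gamma> | w \<gamma>. w \<in> reflection_group a b \<Gamma> \<and> \<gamma> \<in> \<Gamma>}"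

definition int_span :: "vec set \<Rightarrow> vec set" where
  "int_span \<Gamma> = {\<Sum>\<gamma>\<in>F. of_int (c \<gamma>) *\<^sub>R \<gamma> | (c :: vec \<Rightarrow> int) F. finite F \<and> F \<subseteq> \<Gamma>}"

definition Delta :: "int \<Rightarrow> int \<Rightarrow> vec set \<Rightarrow> vec set" where
  "Delta a b \<Gamma> = int_span \<Gamma> \<inter> roots a b"

definition Delta_re :: "int \<Rightarrow> int \<Rightarrow> vec set \<Rightarrow> vec set" where
  "Delta_re a b \<Gamma> = int_span \<Gamma> \<inter> real_roots a b"

lemma reflection_alpha1: "a \<noteq> 0 \<Longrightarrow> b \<noteq> 0 \<Longrightarrow> reflection a b alpha1 = w1 b"
  by (auto simp: fun_eq_iff reflection_def w1_def bform_def alpha1_def alpha2_def field_simps)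

lemma reflection_alpha2: "reflection a b alpha2 = w2 a"
  by (auto simp: fun_eq_iff reflection_def w2_def bform_def alpha1_def alpha2_def field_simps)

end

theory Submission
  imports Defs
begin

text \<open>
  The infinite dihedral group \<open>W\<close> has its reflections naturally indexed by the integers, with
  \<open>r\<^sub>i r\<^sub>j r\<^sub>i = r\<^sub>k\<close> for \<open>k = 2i - j\<close>. With suitable signs the real roots are therefore
  \<open>\<plusminus>\<beta>\<^sub>i\<close> (\<open>i \<in> \<int>\<close>), where \<open>\<beta>\<^sub>0 = -\<alpha>\<^sub>1\<close>, \<open>\<beta>\<^sub>1 = \<alpha>\<^sub>2\<close>, three consecutive roots
  satisfy \<open>\<beta>(i+1) + \<beta>(i-1) = c\<^sub>i \<beta>\<^sub>i\<close> with \<open>c\<^sub>i\<close> alternating between \<open>b\<close> and \<open>a\<close>, and the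
  reflection in \<open>\<beta>\<^sub>i\<close> sends \<open>\<beta>\<^sub>j\<close> to \<open>-\<beta>(2i-j)\<close> (\<open>reflection_beta\<close>). Even indices give the orbit
  of \<open>\<alpha>\<^sub>1\<close>, odd indices that of \<open>\<alpha>\<^sub>2\<close> (\<open>weyl_orbit_alpha1\<close>, \<open>weyl_orbit_alpha2\<close>).

  In this description \<open>\<Phi>(\<Gamma>)\<close> is the set of \<open>\<plusminus>\<beta>\<^sub>j\<close> with \<open>j\<close> in a set \<open>J\<close> of integers
  closed under \<open>(i, j) \<mapsto> 2i - j\<close> (\<open>Phi_eq_signed\<close>), and such a set is an arithmetic progression
  \<open>i + d\<int>\<close> (\<open>point_reflection_closed\<close>). All roots of the progression lie in the lattice spanned by
  \<open>\<beta>(i)\<close> and \<open>\<beta>(i+d)\<close> (\<open>progression_in_lattice\<close>). If \<open>\<Gamma>\<close> generates \<open>\<Delta>\<close>, this lattice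
  contains \<open>\<alpha>\<^sub>1\<close> and \<open>\<alpha>\<^sub>2\<close>, so the determinant of \<open>\<beta>(i)\<close>, \<open>\<beta>(i+d)\<close> is \<open>\<plusminus>1\<close>. But, suitably oriented, this
  determinant is \<open>0\<close>, \<open>1\<close>, \<open>c(i+1)\<close> for \<open>d = 0, 1, 2\<close>, and at least \<open>2\<close> for \<open>d \<ge> 3\<close>
  (\<open>area_beta_ge_2\<close>), which is where \<open>ab \<ge> 4\<close> enters. Hence either \<open>d = 1\<close> and all real roots occur, or
  \<open>d = 2\<close> and \<open>c(i+1) = 1\<close>; as \<open>a \<ge> 2\<close>, the latter forces \<open>b = 1\<close> and \<open>i\<close> odd, which is the
  case of the short roots.
\<close>

section \<open>Orbits under groups generated by involutions\<close>

lemma involution_in_Bij: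
  assumes "\<And>v. f (f v) = v"
  shows "f \<in> Bij UNIV"
  using assms by (auto simp: Bij_def intro!: o_bij[of f f])

lemma inv_BijGroup_involution:
  assumes "\<And>v. f (f v) = v"
  shows "inv\<^bsub>BijGroup UNIV\<^esub> f = f"
proof -
  interpret group "BijGroup UNIV" by (rule group_BijGroup)
  have "f \<in> carrier (BijGroup UNIV)"
    using involution_in_Bij[OF assms] by (simp add: BijGroup_def)
  moreover have "f \<otimes>\<^bsub>BijGroup UNIV\<^esub> f = \<one>\<^bsub>BijGroup UNIV\<^esub>"
    using involution_in_Bij[OF assms] assms
    by (auto simp: BijGroup_def compose_def fun_eq_iff)
  ultimately show ?thesis by (metis inv_equality)
qed

text \<open>For generators that are involutions the inverses are generators again, so a set stable under the
  generators is stable under the whole group. Orbits are thereby described without group elements.\<close>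

context
  fixes R :: "('a \<Rightarrow> 'a) set"
  assumes involution: "\<forall>r\<in>R. \<forall>v. r (r v) = v"
begin

lemma generate_involutions_Bij:
  "w \<in> generate (BijGroup UNIV) R \<Longrightarrow> w \<in> Bij UNIV"
proof -
  interpret group "BijGroup (UNIV :: 'a set)" by (rule group_BijGroup)
  assume "w \<in> generate (BijGroup UNIV) R"
  moreover have "R \<subseteq> carrier (BijGroup UNIV)"
  proof
    fix r assume "r \<in> R"
    then have "r \<in> Bij UNIV" by (intro involution_in_Bij involution[rule_format])
    then show "r \<in> carrier (BijGroup UNIV)" by (simp add: BijGroup_def)
  qed
  ultimately have "w \<in> carrier (BijGroup UNIV)" using generate_in_carrier by metis
  then show ?thesis by (simp add: BijGroup_def)
qed

lemma id_in_generate: "(\<lambda>v. v) \<in> generate (BijGroup UNIV) R"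
  using generate.one[of "BijGroup UNIV" R] by (simp add: BijGroup_def restrict_def)

lemma generate_involutions_step:
  assumes "r \<in> R" and "w \<in> generate (BijGroup UNIV) R"
  shows "(\<lambda>v. r (w v)) \<in> generate (BijGroup UNIV) R"
proof -
  have r: "r \<in> generate (BijGroup UNIV) R" using assms by (simp add: generate.incl)
  from generate.eng[OF r assms(2)] show ?thesis
    using generate_involutions_Bij[OF r] generate_involutions_Bij[OF assms(2)]
    by (simp add: BijGroup_def compose_def restrict_def)
qed

lemma generate_involutions_invariant:
  assumes "w \<in> generate (BijGroup UNIV) R"
    and "\<And>r v. r \<in> R \<Longrightarrow> v \<in> X \<Longrightarrow> r v \<in> X" and "v \<in> X"
  shows "w v \<in> X"
  using assms(1,3)
proof (induction arbitrary: v rule: generate.induct)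
  case one
  then show ?case by (simp add: BijGroup_def)
next
  case (incl h)
  then show ?case by (rule assms(2))
next
  case (inv h)
  have "inv\<^bsub>BijGroup UNIV\<^esub> h = h"
    using inv(1) by (intro inv_BijGroup_involution involution[rule_format])
  then show ?case using assms(2)[OF inv] by simp
next
  case (eng h1 h2)
  then show ?case
    using generate_involutions_Bij[OF eng(1)] generate_involutions_Bij[OF eng(2)]
    by (simp add: BijGroup_def compose_def)
qed

end

lemma bform_linear:
  "bform a b (u + v) w = bform a b u w + bform a b v w"
  "bform a b (u - v) w = bform a b u w - bform a b v w"
  "bform a b (- u) w = - bform a b u w"
  "bform a b (c *\<^sub>R u) w = c * bform a b u w"
  "bform a b w (u + v) = bform a b w u + bform a b w v"
  "bform a b w (u - v) = bform a b w u - bform a b w v"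
  "bform a b w (- u) = - bform a b w u"
  "bform a b w (c *\<^sub>R u) = c * bform a b w u"
  by (simp_all add: bform_def algebra_simps)

lemma bform_commute: "bform a b u v = bform a b v u"
  by (simp add: bform_def algebra_simps)

lemma reflection_linear:
  "reflection a b g (u + v) = reflection a b g u + reflection a b g v"
  "reflection a b g (- u) = - reflection a b g u"
  "reflection a b g (c *\<^sub>R u) = c *\<^sub>R reflection a b g u"
  by (simp_all add: reflection_def bform_linear algebra_simps add_divide_distrib)

lemma reflection_uminus: "reflection a b (- g) = reflection a b g"
  by (simp add: reflection_def bform_linear fun_eq_iff)

lemma reflection_self: "bform a b g g \<noteq> 0 \<Longrightarrow> reflection a b g g = - g"
  by (simp add: reflection_def scaleR_2)

lemma reflection_involution:
  assumes "bform a b g g \<noteq> 0"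
  shows "reflection a b g (reflection a b g v) = v"
  using assms by (simp add: reflection_def bform_linear algebra_simps)

text \<open>The next lemmas say that \<open>\<Phi>(\<Gamma>)\<close> is the least superset of \<open>\<Gamma>\<close> that is stable under the
  reflections in \<open>\<Gamma>\<close>, which removes the group from all later arguments.\<close>

context
  fixes a b :: int and \<Gamma> :: "vec set"
  assumes nonisotropic: "\<And>g. g \<in> \<Gamma> \<Longrightarrow> bform a b g g \<noteq> 0"
begin

private lemma reflections_involutive:
  "\<forall>r\<in>reflection a b ` \<Gamma>. \<forall>v. r (r v) = v"
  using nonisotropic reflection_involution by blast

lemma subset_Phi: "\<Gamma> \<subseteq> Phi a b \<Gamma>"
  using id_in_generate[of "reflection a b ` \<Gamma>", OF reflections_involutive]
  by (force simp: Phi_def reflection_group_def)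

lemma reflection_in_Phi:
  assumes "g \<in> \<Gamma>" and "v \<in> Phi a b \<Gamma>"
  shows "reflection a b g v \<in> Phi a b \<Gamma>"
proof -
  obtain w h where w: "w \<in> reflection_group a b \<Gamma>" "h \<in> \<Gamma>" "v = w h"
    using assms(2) by (auto simp: Phi_def)
  have "(\<lambda>v. reflection a b g (w v)) \<in> reflection_group a b \<Gamma>"
    using generate_involutions_step[of "reflection a b ` \<Gamma>", OF reflections_involutive] w(1) assms(1)
    by (auto simp: reflection_group_def)
  then have "reflection a b g (w h) \<in> Phi a b \<Gamma>"
    unfolding Phi_def using w(2) by (intro CollectI exI conjI) auto
  then show ?thesis using w(3) by simp
qed

lemma Phi_least:
  assumes "\<Gamma> \<subseteq> X" and "\<And>g v. g \<in> \<Gamma> \<Longrightarrow> v \<in> X \<Longrightarrow> reflection a b g v \<in> X"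
  shows "Phi a b \<Gamma> \<subseteq> X"
proof
  fix v assume "v \<in> Phi a b \<Gamma>"
  then obtain w h where w: "w \<in> reflection_group a b \<Gamma>" "h \<in> \<Gamma>" "v = w h"
    by (auto simp: Phi_def)
  have "w h \<in> X"
  proof (rule generate_involutions_invariant[where w = w and X = X and v = h, OF reflections_involutive])
    show "w \<in> generate (BijGroup UNIV) (reflection a b ` \<Gamma>)"
      using w(1) by (simp add: reflection_group_def)
    show "r v \<in> X" if "r \<in> reflection a b ` \<Gamma>" "v \<in> X" for r v
    proof -
      from that(1) obtain g where "r = reflection a b g" "g \<in> \<Gamma>" by (rule imageE)
      then show ?thesis using assms(2) that(2) by simp
    qed
    show "h \<in> X" using w(2) assms(1) by blast
  qed
  then show "v \<in> X" using w(3) by simp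
qed

text \<open>The roots whose negative also lies in \<open>\<Phi>(\<Gamma>)\<close> form a set to which minimality applies; it
  contains \<open>\<Gamma>\<close> because every root is negated by its own reflection.\<close>

lemma uminus_in_Phi:
  assumes "v \<in> Phi a b \<Gamma>"
  shows "- v \<in> Phi a b \<Gamma>"
proof -
  have "Phi a b \<Gamma> \<subseteq> {v \<in> Phi a b \<Gamma>. - v \<in> Phi a b \<Gamma>}"
  proof (rule Phi_least)
    have "- g \<in> Phi a b \<Gamma>" if "g \<in> \<Gamma>" for g
      using reflection_in_Phi[OF that, of g] that subset_Phi nonisotropic
      by (auto simp: reflection_self)
    then show "\<Gamma> \<subseteq> {v \<in> Phi a b \<Gamma>. - v \<in> Phi a b \<Gamma>}" using subset_Phi by blast
    show "reflection a b g v \<in> {v \<in> Phi a b \<Gamma>. - v \<in> Phi a b \<Gamma>}"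
      if "g \<in> \<Gamma>" "v \<in> {v \<in> Phi a b \<Gamma>. - v \<in> Phi a b \<Gamma>}" for g v
      using reflection_in_Phi[OF that(1), of v] reflection_in_Phi[OF that(1), of "- v"] that(2)
      by (simp add: reflection_linear)
  qed
  then show ?thesis using assms by blast
qed

end

section \<open>Sets of integers closed under point reflections\<close>

text \<open>The difference \<open>d\<close> of the progression is the smallest distance of two distinct elements:
  repeated reflection of such a pair fills the progression, and an element off the progression
  would be closer than \<open>d\<close> to one on it. A singleton is the case \<open>d = 0\<close>.\<close>

lemma point_reflection_closed:
  fixes J :: "int set"
  assumes "J \<noteq> {}" and closed: "\<And>i j. i \<in> J \<Longrightarrow> j \<in> J \<Longrightarrow> 2 * i - j \<in> J"
  obtains i :: int and d :: nat where "J = range (\<lambda>k. i + int d * k)"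
proof (cases "\<exists>d>0. \<exists>i\<in>J. i + int d \<in> J")
  case False
  then have no_pair: "i + int d \<notin> J" if "i \<in> J" "d > 0" for i d using that by blast
  obtain i where i: "i \<in> J" using assms(1) by blast
  have "j = i" if "j \<in> J" for j
  proof (rule ccontr)
    assume "j \<noteq> i"
    then consider "i < j" | "j < i" by linarith
    then show False
    proof cases
      case 1
      then show False using no_pair[of i "nat (j - i)"] i that by simp
    next
      case 2
      then show False using no_pair[of j "nat (i - j)"] i that by simp
    qed
  qed
  then have "J = {i}" using i by blast
  then have "J = range (\<lambda>k. i + int 0 * k)" by simp
  then show ?thesis by (rule that)
next
  case True
  define d where "d = (LEAST d. d > 0 \<and> (\<exists>i\<in>J. i + int d \<in> J))"
  have d: "d > 0" "\<exists>i\<in>J. i + int d \<in> J"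
    using LeastI_ex[OF True] by (auto simp: d_def)
  have least: "d \<le> e" if "e > 0" "i \<in> J" "i + int e \<in> J" for e i
    unfolding d_def using that by (intro Least_le) blast
  obtain i where i: "i \<in> J" "i + int d \<in> J" using d(2) by blast
  have progression: "i + int d * k \<in> J \<and> i + int d * (k + 1) \<in> J" for k
  proof (induction k rule: int_induct[where k = 0])
    case base
    then show ?case using i by simp
  next
    case (step1 k)
    have "2 * (i + int d * (k + 1)) - (i + int d * k) = i + int d * (k + 1 + 1)"
      by (simp add: algebra_simps)
    with step1 closed show ?case by metis
  next
    case (step2 k)
    have "2 * (i + int d * k) - (i + int d * (k + 1)) = i + int d * (k - 1)"
      by (simp add: algebra_simps)
    with step2 closed show ?case by (metis diff_add_cancel)
  qed
  have "j \<in> range (\<lambda>k. i + int d * k)" if j: "j \<in> J" for j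
  proof -
    define k e where "k = (j - i) div int d" and "e = nat ((j - i) mod int d)"
    have e: "e < d" "j = i + int d * k + int e"
      using d(1) by (simp_all add: e_def k_def nat_less_iff)
    have "e = 0"
      using least[of e "i + int d * k"] progression[of k] j e by force
    then show ?thesis using e(2) by auto
  qed
  then have "J = range (\<lambda>k. i + int d * k)" using progression by auto
  then show ?thesis by (rule that)
qed

section \<open>The real roots as a two-sided sequence\<close>

text \<open>Identities between sequences obeying the recurrence of the real roots need only be checked at two
  consecutive indices.\<close>

lemma two_term_recurrence_unique:
  fixes f g :: "int \<Rightarrow> 'a :: real_vector"
  assumes f: "\<And>i. f (i + 1) + f (i - 1) = c i *\<^sub>R f i"
    and g: "\<And>i. g (i + 1) + g (i - 1) = c i *\<^sub>R g i"
    and init: "f k = g k" "f (k + 1) = g (k + 1)"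
  shows "f j = g j"
proof -
  have f': "f (i + 1) = c i *\<^sub>R f i - f (i - 1)" "f (i - 1) = c i *\<^sub>R f i - f (i + 1)" for i
    using f[of i] by (metis add_diff_cancel_right' add_diff_cancel_left')+
  have g': "g (i + 1) = c i *\<^sub>R g i - g (i - 1)" "g (i - 1) = c i *\<^sub>R g i - g (i + 1)" for i
    using g[of i] by (metis add_diff_cancel_right' add_diff_cancel_left')+
  have "f j = g j \<and> f (j + 1) = g (j + 1)"
  proof (induction j rule: int_induct[where k = k])
    case base
    then show ?case using init by simp
  next
    case (step1 i)
    then show ?case using f'(1)[of "i + 1"] g'(1)[of "i + 1"] by simp
  next
    case (step2 i)
    then show ?case using f'(2)[of i] g'(2)[of i] by simp
  qed
  then show ?thesis by simp
qed

locale infinite_rank2 =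
  fixes a b :: int
  assumes b_le_a: "a \<ge> b" and b_pos: "b \<ge> 1" and ab_ge_4: "a * b \<ge> 4"
begin

lemma a_ge_2: "a \<ge> 2"
proof (rule ccontr)
  assume "\<not> a \<ge> 2"
  then have "a = 1" "b = 1" using b_le_a b_pos by auto
  then show False using ab_ge_4 by simp
qed

definition link :: "int \<Rightarrow> int" where
  "link i = (if even i then b else a)"

lemma link_pos: "link i \<ge> 1"
  using b_le_a b_pos by (simp add: link_def)

text \<open>The sign \<open>\<beta>\<^sub>0 = -\<alpha>\<^sub>1\<close> makes one recurrence, and one sign in the action of reflections, valid
  for all indices.\<close>

function beta :: "int \<Rightarrow> vec" where
  "beta i =
     (if i = 0 then - alpha1 else if i = 1 then alpha2
      else if i > 1 then of_int (link (i - 1)) *\<^sub>R beta (i - 1) - beta (i - 2)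
      else of_int (link (i + 1)) *\<^sub>R beta (i + 1) - beta (i + 2))"
  by auto
termination by (relation "measure (\<lambda>i. nat \<bar>2 * i - 1\<bar>)") auto

declare beta.simps [simp del]

lemma beta_0: "beta 0 = - alpha1" and beta_1: "beta 1 = alpha2"
  by (simp_all add: beta.simps)

lemma beta_recurrence: "beta (i + 1) + beta (i - 1) = of_int (link i) *\<^sub>R beta i"
proof (cases "i \<ge> 1")
  case True
  then show ?thesis by (subst beta.simps[of "i + 1"]) simp
next
  case False
  then show ?thesis by (subst beta.simps[of "i - 1"]) (simp add: algebra_simps)
qed

lemma beta_Suc: "beta (i + 1) = of_int (link i) *\<^sub>R beta i - beta (i - 1)"
  using beta_recurrence[of i] by (metis add_diff_cancel_right')

lemma beta_pred: "beta (i - 1) = of_int (link i) *\<^sub>R beta i - beta (i + 1)"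
  using beta_recurrence[of i] by (metis add_diff_cancel_left')

definition sqlen :: "int \<Rightarrow> real" where
  "sqlen i = (if even i then 2 * a / b else 2)"

lemma sqlen_pos: "sqlen i > 0"
  using a_ge_2 b_pos by (simp add: sqlen_def)

lemma link_sqlen: "link i * sqlen i = 2 * a"
  using b_pos by (simp add: link_def sqlen_def)

lemma bform_beta_aux:
  "bform a b (beta i) (beta i) = sqlen i \<and> bform a b (beta (i + 1)) (beta (i + 1)) = sqlen (i + 1)
   \<and> bform a b (beta i) (beta (i + 1)) = a"
proof (induction i rule: int_induct[where k = 0])
  case base
  then show ?case
    by (simp add: beta_0 beta_1 bform_def alpha1_def alpha2_def sqlen_def)
next
  case (step1 i)
  have b: "beta (i + 1 + 1) = of_int (link (i + 1)) *\<^sub>R beta (i + 1) - beta i"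
    using beta_Suc[of "i + 1"] by simp
  show ?case
    unfolding b
    using step1.IH link_sqlen[of "i + 1"] bform_commute[of a b "beta (i + 1)" "beta i"]
    by (simp add: bform_linear sqlen_def)
next
  case (step2 i)
  have "sqlen (i - 1) = sqlen (i + 1)" by (simp add: sqlen_def)
  then show ?case
    unfolding beta_pred[of i]
    using step2.IH link_sqlen[of i] bform_commute[of a b "beta (i + 1)" "beta i"]
    by (simp add: bform_linear)
qed

lemma bform_beta: "bform a b (beta i) (beta i) = sqlen i"
  and bform_beta_Suc: "bform a b (beta i) (beta (i + 1)) = a"
  using bform_beta_aux by auto

lemma bform_beta_nonzero: "bform a b (beta i) (beta i) \<noteq> 0"
  using sqlen_pos[of i] by (simp add: bform_beta)

text \<open>Both sides satisfy the recurrence of \<open>\<beta>\<close> in \<open>j\<close>, because \<open>j\<close> and \<open>2i - j\<close> have the same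
  parity, so it is enough to compare them at \<open>j = i\<close> and \<open>j = i + 1\<close>.\<close>

lemma reflection_beta: "reflection a b (beta i) (beta j) = - beta (2 * i - j)"
proof (rule two_term_recurrence_unique[where f = "\<lambda>j. reflection a b (beta i) (beta j)"
      and g = "\<lambda>j. - beta (2 * i - j)" and c = "\<lambda>j. of_int (link j)" and k = i])
  show "reflection a b (beta i) (beta (j + 1)) + reflection a b (beta i) (beta (j - 1)) =
      of_int (link j) *\<^sub>R reflection a b (beta i) (beta j)" for j
    by (metis beta_recurrence reflection_linear(1,3))
  show "- beta (2 * i - (j + 1)) + - beta (2 * i - (j - 1)) =
      of_int (link j) *\<^sub>R - beta (2 * i - j)" for j
    using beta_recurrence[of "2 * i - j"] by (simp add: link_def algebra_simps)
  show "reflection a b (beta i) (beta i) = - beta (2 * i - i)"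
    by (simp add: reflection_self bform_beta_nonzero)
  have "2 * real_of_int a / sqlen i = link i"
    using link_sqlen[of i] sqlen_pos[of i] by (simp add: field_simps)
  then show "reflection a b (beta i) (beta (i + 1)) = - beta (2 * i - (i + 1))"
    using beta_pred[of i] bform_beta_Suc[of i] bform_commute[of a b "beta (i + 1)" "beta i"]
    by (simp add: reflection_def bform_beta)
qed

definition signed :: "int set \<Rightarrow> vec set" where
  "signed J = beta ` J \<union> (\<lambda>j. - beta j) ` J"

lemma signedE:
  assumes "v \<in> signed J"
  obtains j where "j \<in> J" "v = beta j \<or> v = - beta j"
  using assms by (auto simp: signed_def)

lemma signedI: "j \<in> J \<Longrightarrow> beta j \<in> signed J" "j \<in> J \<Longrightarrow> - beta j \<in> signed J"
  by (auto simp: signed_def)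

lemma reflection_signed:
  assumes "v \<in> signed J" and "\<And>j. j \<in> J \<Longrightarrow> 2 * i - j \<in> J"
  shows "reflection a b (beta i) v \<in> signed J"
proof -
  obtain j where j: "j \<in> J" "v = beta j \<or> v = - beta j" using assms(1) by (rule signedE)
  then have "reflection a b (beta i) v = - beta (2 * i - j) \<or> reflection a b (beta i) v = beta (2 * i - j)"
    by (auto simp: reflection_beta reflection_linear)
  then show ?thesis using signedI[OF assms(2)[OF j(1)]] by auto
qed

lemma w1_reflection: "w1 b = reflection a b (beta 0)"
  using reflection_alpha1[of a b] a_ge_2 b_pos by (simp add: beta_0 reflection_uminus)

lemma w2_reflection: "w2 a = reflection a b (beta 1)"
  by (simp add: beta_1 reflection_alpha2)

lemma simple_reflections_involutive: "\<forall>r\<in>{w1 b, w2 a}. \<forall>v. r (r v) = v"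
  by (auto simp: w1_reflection w2_reflection reflection_involution bform_beta_nonzero)

lemma weyl_orbit_least:
  assumes "v \<in> X" and "\<And>u. u \<in> X \<Longrightarrow> w1 b u \<in> X" and "\<And>u. u \<in> X \<Longrightarrow> w2 a u \<in> X"
  shows "weyl_orbit a b v \<subseteq> X"
proof
  fix u assume "u \<in> weyl_orbit a b v"
  then obtain w where w: "w \<in> generate (BijGroup UNIV) {w1 b, w2 a}" "u = w v"
    by (auto simp: weyl_orbit_def weyl_group_def)
  have "w v \<in> X"
    by (rule generate_involutions_invariant[where w = w and X = X and v = v, OF simple_reflections_involutive w(1)])
       (use assms in blast)+
  then show "u \<in> X" using w(2) by simp
qed

lemma self_in_weyl_orbit: "v \<in> weyl_orbit a b v"
  using id_in_generate[of "{w1 b, w2 a}", OF simple_reflections_involutive]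
  by (force simp: weyl_orbit_def weyl_group_def)

lemma weyl_orbit_closed:
  assumes "u \<in> weyl_orbit a b v" and "r \<in> {w1 b, w2 a}"
  shows "r u \<in> weyl_orbit a b v"
proof -
  obtain w where w: "w \<in> weyl_group a b" "u = w v"
    using assms(1) by (auto simp: weyl_orbit_def)
  have "(\<lambda>v. r (w v)) \<in> weyl_group a b"
    using generate_involutions_step[of "{w1 b, w2 a}" r w, OF simple_reflections_involutive]
      w(1) assms(2) by (simp add: weyl_group_def)
  then show ?thesis using w(2) by (auto simp: weyl_orbit_def)
qed

text \<open>The products \<open>w\<^sub>2w\<^sub>1\<close> and \<open>w\<^sub>1w\<^sub>2\<close> shift the index by \<open>2\<close> and \<open>-2\<close>, and a single reflection
  changes the sign. The scalar \<open>e\<close> stands for either sign.\<close>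

lemma shift_in_weyl_orbit:
  assumes "e *\<^sub>R beta j \<in> weyl_orbit a b v"
  shows "e *\<^sub>R beta (j + 2 * k) \<in> weyl_orbit a b v"
    and "- e *\<^sub>R beta (j + 2 * k) \<in> weyl_orbit a b v"
proof -
  have w1: "w1 b (e *\<^sub>R beta i) = - e *\<^sub>R beta (- i)" for i and e :: real
    by (simp add: w1_reflection reflection_linear reflection_beta)
  have w2: "w2 a (e *\<^sub>R beta i) = - e *\<^sub>R beta (2 - i)" for i and e :: real
    by (simp add: w2_reflection reflection_linear reflection_beta)
  have closed: "w1 b u \<in> weyl_orbit a b v" "w2 a u \<in> weyl_orbit a b v"
    if "u \<in> weyl_orbit a b v" for u
    using weyl_orbit_closed that by auto
  have pos: "e *\<^sub>R beta (j + 2 * k) \<in> weyl_orbit a b v" for k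
  proof (induction k rule: int_induct[where k = 0])
    case base
    then show ?case using assms by simp
  next
    case (step1 k)
    have "w2 a (w1 b (e *\<^sub>R beta (j + 2 * k))) = e *\<^sub>R beta (j + 2 * (k + 1))"
      unfolding w1 w2 by (simp add: algebra_simps)
    then show ?case using closed step1.IH by metis
  next
    case (step2 k)
    have "w1 b (w2 a (e *\<^sub>R beta (j + 2 * k))) = e *\<^sub>R beta (j + 2 * (k - 1))"
      unfolding w1 w2 by (simp add: algebra_simps)
    then show ?case using closed step2.IH by metis
  qed
  show "e *\<^sub>R beta (j + 2 * k) \<in> weyl_orbit a b v" by (rule pos)
  have "w1 b (e *\<^sub>R beta (j + 2 * (- j - k))) = - e *\<^sub>R beta (j + 2 * k)"
    unfolding w1 by (simp add: algebra_simps)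
  then show "- e *\<^sub>R beta (j + 2 * k) \<in> weyl_orbit a b v" using closed pos by metis
qed

lemma weyl_orbit_alpha1: "weyl_orbit a b alpha1 = signed {i. even i}"
proof
  have "alpha1 = - beta 0" by (simp add: beta_0)
  then have "alpha1 \<in> signed {i. even i}" using signedI(2)[of 0 "{i. even i}"] by simp
  then show "weyl_orbit a b alpha1 \<subseteq> signed {i. even i}"
    by (rule weyl_orbit_least)
       (auto simp: w1_reflection w2_reflection intro!: reflection_signed)
  show "signed {i. even i} \<subseteq> weyl_orbit a b alpha1"
    using shift_in_weyl_orbit[of "-1" 0 alpha1] self_in_weyl_orbit[of alpha1]
    by (auto simp: beta_0 elim!: signedE evenE)
qed

lemma weyl_orbit_alpha2: "weyl_orbit a b alpha2 = signed {i. odd i}"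
proof
  have "alpha2 \<in> signed {i. odd i}" using signedI(1)[of 1 "{i. odd i}"] by (simp add: beta_1)
  then show "weyl_orbit a b alpha2 \<subseteq> signed {i. odd i}"
    by (rule weyl_orbit_least)
       (auto simp: w1_reflection w2_reflection intro!: reflection_signed)
  show "signed {i. odd i} \<subseteq> weyl_orbit a b alpha2"
    using shift_in_weyl_orbit[of 1 1 alpha2] self_in_weyl_orbit[of alpha2]
    by (auto simp: beta_1 add.commute elim!: signedE oddE)
qed

lemma real_roots_eq_signed: "real_roots a b = signed UNIV"
  unfolding real_roots_def weyl_orbit_alpha1 weyl_orbit_alpha2 by (auto simp: signed_def)

text \<open>For \<open>a > b\<close> the two orbits differ in squared length, \<open>2a/b\<close> against \<open>2\<close>. So the two alternatives for
  \<open>\<Phi>(\<Gamma>)\<close> exclude each other.\<close>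

lemma alpha1_not_in_orbit_alpha2:
  assumes "a > b"
  shows "alpha1 \<notin> weyl_orbit a b alpha2"
proof
  assume "alpha1 \<in> weyl_orbit a b alpha2"
  then obtain j where "odd j" "alpha1 = beta j \<or> alpha1 = - beta j"
    unfolding weyl_orbit_alpha2 by (auto elim: signedE)
  then have "bform a b alpha1 alpha1 = 2"
    using bform_beta[of j] bform_linear(3)[of a b "beta j" "- beta j"]
      bform_linear(7)[of a b "beta j" "beta j"] by (auto simp: sqlen_def)
  moreover have "bform a b alpha1 alpha1 = 2 * a / b" by (simp add: bform_def alpha1_def)
  ultimately show False using assms b_pos by (simp add: field_simps)
qed

section \<open>The reflection closure of a set of real roots\<close>

text \<open>Closure of \<open>J\<close> under reflection in its own elements, and not only in the indices of \<open>\<Gamma>\<close>,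
  corresponds to \<open>w\<^sub>\<alpha> = w w\<^sub>\<gamma> w\<^sup>-\<^sup>1\<close> for \<open>\<alpha> = w \<gamma>\<close>. On indices it follows because the points in which
  \<open>J\<close> is symmetric are themselves stable under reflection in one another.\<close>

lemma Phi_eq_signed:
  assumes "\<Gamma> \<subseteq> real_roots a b"
  obtains J where "Phi a b \<Gamma> = signed J" and "\<And>i j. i \<in> J \<Longrightarrow> j \<in> J \<Longrightarrow> 2 * i - j \<in> J"
proof -
  have index: "\<exists>i. g = beta i \<or> g = - beta i" if "g \<in> \<Gamma>" for g
    using assms that unfolding real_roots_eq_signed by (blast elim: signedE)
  have nonisotropic: "bform a b g g \<noteq> 0" if "g \<in> \<Gamma>" for g
    using index[OF that] bform_beta_nonzero by (auto simp: bform_linear)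
  note Phi_refl = reflection_in_Phi[of \<Gamma> a b, OF nonisotropic]
    and Phi_least = Phi_least[of \<Gamma> a b, OF nonisotropic]
    and Phi_uminus = uminus_in_Phi[of \<Gamma> a b, OF nonisotropic]
  define J where "J = {j. beta j \<in> Phi a b \<Gamma>}"
  define K where "K = {i. \<forall>j\<in>J. 2 * i - j \<in> J}"
  have signed_refl: "reflection a b g v \<in> signed L"
    if "g \<in> \<Gamma>" "v \<in> signed L" "\<And>i j. g = beta i \<or> g = - beta i \<Longrightarrow> j \<in> L \<Longrightarrow> 2 * i - j \<in> L" for g v L
  proof -
    obtain i where i: "g = beta i \<or> g = - beta i" using index[OF \<open>g \<in> \<Gamma>\<close>] by blast
    then have "reflection a b g = reflection a b (beta i)" by (auto simp: reflection_uminus)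
    then show ?thesis using reflection_signed[of v L i] that(2,3) i by auto
  qed
  have \<Gamma>_K: "i \<in> K" if "g \<in> \<Gamma>" "g = beta i \<or> g = - beta i" for g i
  proof -
    have "beta (2 * i - j) \<in> Phi a b \<Gamma>" if "j \<in> J" for j
    proof -
      have "reflection a b g (beta j) = - beta (2 * i - j)"
        using \<open>g = beta i \<or> g = - beta i\<close> by (auto simp: reflection_uminus reflection_beta)
      then show ?thesis
        using Phi_refl[OF _ \<open>g \<in> \<Gamma>\<close>, of "beta j"] Phi_uminus[of "- beta (2 * i - j)"] that
        by (auto simp: J_def)
    qed
    then show ?thesis by (simp add: K_def J_def)
  qed
  have K_closed: "2 * i - k \<in> K" if "i \<in> K" "k \<in> K" for i k
  proof -
    have "2 * (2 * i - k) - j \<in> J" if "j \<in> J" for j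
    proof -
      have "2 * i - (2 * k - (2 * i - j)) \<in> J"
        using \<open>i \<in> K\<close> \<open>k \<in> K\<close> that unfolding K_def by blast
      also have "2 * i - (2 * k - (2 * i - j)) = 2 * (2 * i - k) - j" by simp
      finally show ?thesis .
    qed
    then show ?thesis by (simp add: K_def)
  qed
  have "Phi a b \<Gamma> \<subseteq> signed K"
  proof (rule Phi_least)
    show "\<Gamma> \<subseteq> signed K" using index \<Gamma>_K signedI by blast
    show "reflection a b g v \<in> signed K" if "g \<in> \<Gamma>" "v \<in> signed K" for g v
      using signed_refl[OF that] \<Gamma>_K[OF that(1)] K_closed by blast
  qed auto
  show thesis
  proof
    have "Phi a b \<Gamma> \<subseteq> signed UNIV"
      using assms signed_refl by (intro Phi_least) (auto simp: real_roots_eq_signed)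
    show Phi_J: "Phi a b \<Gamma> = signed J"
    proof
      show "Phi a b \<Gamma> \<subseteq> signed J"
      proof
        fix v assume v: "v \<in> Phi a b \<Gamma>"
        then obtain j where "v = beta j \<or> v = - beta j"
          using \<open>Phi a b \<Gamma> \<subseteq> signed UNIV\<close> by (blast elim: signedE)
        then show "v \<in> signed J"
          using v Phi_uminus[of v] by (auto simp: J_def intro: signedI)
      qed
      show "signed J \<subseteq> Phi a b \<Gamma>"
        unfolding signed_def J_def using Phi_uminus by blast
    qed
    show "2 * i - j \<in> J" if "i \<in> J" "j \<in> J" for i j
    proof -
      have "beta i \<in> signed K" using \<open>Phi a b \<Gamma> \<subseteq> signed K\<close> that(1) by (auto simp: J_def)
      then obtain k where k: "k \<in> K" "beta i = beta k \<or> beta i = - beta k"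
        by (blast elim: signedE)
      \<comment> \<open>Equal reflections give the same mirror image of \<open>\<beta>\<^sub>j\<close>, whether or not \<open>i = k\<close>.\<close>
      then have "reflection a b (beta i) (beta j) = reflection a b (beta k) (beta j)"
        by (metis reflection_uminus)
      then have "beta (2 * i - j) = beta (2 * k - j)" by (simp add: reflection_beta)
      then show ?thesis using k(1) that(2) by (auto simp: J_def K_def)
    qed
  qed
qed

section \<open>The lattice and the determinant of a pair of roots\<close>

definition pair_lattice :: "vec \<Rightarrow> vec \<Rightarrow> vec set" where
  "pair_lattice u v = {of_int m *\<^sub>R u + of_int n *\<^sub>R v | m n :: int. True}"

lemma pair_latticeI: "of_int m *\<^sub>R u + of_int n *\<^sub>R v \<in> pair_lattice u v"
  by (auto simp: pair_lattice_def)

lemma pair_lattice_add: "x \<in> pair_lattice u v \<Longrightarrow> y \<in> pair_lattice u v \<Longrightarrow> x + y \<in> pair_lattice u v"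
proof -
  assume "x \<in> pair_lattice u v" "y \<in> pair_lattice u v"
  then obtain m n m' n' :: int where "x = of_int m *\<^sub>R u + of_int n *\<^sub>R v"
    "y = of_int m' *\<^sub>R u + of_int n' *\<^sub>R v" by (auto simp: pair_lattice_def)
  then have "x + y = of_int (m + m') *\<^sub>R u + of_int (n + n') *\<^sub>R v"
    by (simp add: algebra_simps)
  then show ?thesis using pair_latticeI by metis
qed

lemma pair_lattice_scale: "x \<in> pair_lattice u v \<Longrightarrow> of_int k *\<^sub>R x \<in> pair_lattice u v"
proof -
  assume "x \<in> pair_lattice u v"
  then obtain m n :: int where "x = of_int m *\<^sub>R u + of_int n *\<^sub>R v" by (auto simp: pair_lattice_def)
  then have "of_int k *\<^sub>R x = of_int (k * m) *\<^sub>R u + of_int (k * n) *\<^sub>R v"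
    by (simp add: algebra_simps)
  then show ?thesis using pair_latticeI by metis
qed

lemma pair_lattice_uminus: "x \<in> pair_lattice u v \<Longrightarrow> - x \<in> pair_lattice u v"
  using pair_lattice_scale[of x u v "-1"] by simp

lemma int_span_subset_lattice:
  assumes "\<Gamma> \<subseteq> pair_lattice u v"
  shows "int_span \<Gamma> \<subseteq> pair_lattice u v"
proof
  fix x assume "x \<in> int_span \<Gamma>"
  then obtain c F where "finite F" "F \<subseteq> \<Gamma>" and x: "x = (\<Sum>\<gamma>\<in>F. of_int (c \<gamma>) *\<^sub>R \<gamma>)"
    by (auto simp: int_span_def)
  from this(1,2) have "(\<Sum>\<gamma>\<in>F. of_int (c \<gamma>) *\<^sub>R \<gamma>) \<in> pair_lattice u v"
  proof (induction F)
    case empty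
    then show ?case using pair_latticeI[of 0 u 0 v] by simp
  next
    case (insert \<gamma> F)
    then show ?case using assms by (auto intro!: pair_lattice_add pair_lattice_scale)
  qed
  then show "x \<in> pair_lattice u v" using x by simp
qed

text \<open>The integer \<open>t\<close> is the Cartan integer of \<open>\<beta>(j)\<close> with respect to \<open>\<beta>(i)\<close>, for \<open>j = i + m\<close>. Its
  integrality follows from the recurrence in \<open>m\<close>.\<close>

lemma beta_sum_symmetric:
  fixes i :: int and m :: nat
  shows "\<exists>t :: int. beta (i + m) + beta (i - m) = of_int t *\<^sub>R beta i"
proof -
  have "(\<exists>t :: int. beta (i + m) + beta (i - m) = of_int t *\<^sub>R beta i) \<and>
      (\<exists>t :: int. beta (i + m + 1) + beta (i - m - 1) = of_int t *\<^sub>R beta i)"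
  proof (induction m)
    case 0
    have "beta i + beta i = of_int 2 *\<^sub>R beta i" by (simp add: scaleR_2)
    then have "\<exists>t :: int. beta i + beta i = of_int t *\<^sub>R beta i" by blast
    then show ?case using beta_recurrence[of i] by auto
  next
    case (Suc m)
    then obtain s t :: int where
      s: "beta (i + m) + beta (i - m) = of_int s *\<^sub>R beta i" and
      t: "beta (i + m + 1) + beta (i - m - 1) = of_int t *\<^sub>R beta i" by blast
    let ?l = "link (i + m + 1)"
    have l: "link (i - m - 1) = ?l" by (simp add: link_def)
    have "beta (i + Suc m + 1) + beta (i - Suc m - 1)
        = of_int ?l *\<^sub>R (beta (i + m + 1) + beta (i - m - 1)) - (beta (i + m) + beta (i - m))"
      using beta_Suc[of "i + m + 1"] beta_pred[of "i - m - 1"] l by (simp add: algebra_simps)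
    also have "\<dots> = of_int (?l * t - s) *\<^sub>R beta i" by (simp add: s t scaleR_diff_left)
    finally have "beta (i + Suc m + 1) + beta (i - Suc m - 1) = of_int (?l * t - s) *\<^sub>R beta i" .
    moreover have "beta (i + Suc m) + beta (i - Suc m) = of_int t *\<^sub>R beta i"
      using t by (simp add: algebra_simps)
    ultimately show ?case by blast
  qed
  then show ?thesis by blast
qed

text \<open>Mirroring a root of the progression in its neighbour changes it only by a sign and an integer
  multiple of the neighbour, so two neighbours generate all of them.\<close>

lemma progression_in_lattice:
  fixes i :: int and d :: nat
  shows "beta (i + int d * k) \<in> pair_lattice (beta i) (beta (i + d))"
proof -
  let ?L = "pair_lattice (beta i) (beta (i + d))"
  have mirror: "beta (j + d) \<in> ?L \<longleftrightarrow> beta (j - d) \<in> ?L" if "beta j \<in> ?L" for j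
  proof -
    obtain t :: int where t: "beta (j + d) + beta (j - d) = of_int t *\<^sub>R beta j"
      using beta_sum_symmetric by blast
    have "beta (j + d) = of_int t *\<^sub>R beta j + - beta (j - d)"
      "beta (j - d) = of_int t *\<^sub>R beta j + - beta (j + d)"
      using t by (metis add_diff_cancel_left' add_diff_cancel_right' diff_conv_add_uminus)+
    then show ?thesis using that pair_lattice_scale pair_lattice_add pair_lattice_uminus by metis
  qed
  have "beta (i + int d * k) \<in> ?L \<and> beta (i + int d * (k + 1)) \<in> ?L"
  proof (induction k rule: int_induct[where k = 0])
    case base
    then show ?case using pair_latticeI[of 1 "beta i" 0 "beta (i + d)"] pair_latticeI[of 0 "beta i" 1 "beta (i + d)"]
      by simp
  next
    case (step1 k)
    then show ?case using mirror[of "i + int d * (k + 1)"] by (simp add: algebra_simps)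
  next
    case (step2 k)
    then show ?case using mirror[of "i + int d * k"] by (simp add: algebra_simps)
  qed
  then show ?thesis by simp
qed

text \<open>The determinant of two vectors, oriented such that two consecutive roots have area \<open>1\<close>.\<close>

definition area :: "vec \<Rightarrow> vec \<Rightarrow> real" where
  "area u v = snd u * fst v - fst u * snd v"

lemma area_linear:
  "area u (v + w) = area u v + area u w" "area u (v - w) = area u v - area u w"
  "area (v + w) u = area v u + area w u" "area (v - w) u = area v u - area w u"
  "area u (c *\<^sub>R v) = c * area u v" "area (c *\<^sub>R v) u = c * area v u"
  "area u u = 0"
  by (simp_all add: area_def algebra_simps)

lemma area_commute: "area u v = - area v u"
  by (simp add: area_def)

lemma area_beta_Suc: "area (beta i) (beta (i + 1)) = 1"
proof (induction i rule: int_induct[where k = 0])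
  case base
  then show ?case by (simp add: beta_0 beta_1 area_def alpha1_def alpha2_def)
next
  case (step1 i)
  then show ?case
    unfolding beta_Suc[of "i + 1"] using area_commute[of "beta (i + 1)" "beta i"]
    by (simp add: area_linear)
next
  case (step2 i)
  then show ?case
    unfolding beta_pred[of i] using area_commute[of "beta (i + 1)" "beta i"]
    by (simp add: area_linear)
qed

lemma area_beta_step2: "area (beta i) (beta (i + 2)) = link (i + 1)"
proof -
  have "beta (i + 2) = of_int (link (i + 1)) *\<^sub>R beta (i + 1) - beta i"
    using beta_Suc[of "i + 1"] by (simp add: add.assoc)
  then show ?thesis by (simp add: area_linear area_beta_Suc)
qed

lemma beta_step2_recurrence: "beta (i + 2) = of_int (a * b - 2) *\<^sub>R beta i - beta (i - 2)"
proof -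
  have "beta (i + 2) = of_int (link (i + 1)) *\<^sub>R beta (i + 1) - beta i"
    "beta (i - 2) = of_int (link (i + 1)) *\<^sub>R beta (i - 1) - beta i"
    using beta_Suc[of "i + 1"] beta_pred[of "i - 1"] by (simp_all add: link_def algebra_simps)
  then have "beta (i + 2) + beta (i - 2)
      = of_int (link (i + 1)) *\<^sub>R (beta (i + 1) + beta (i - 1)) - 2 *\<^sub>R beta i"
    by (simp add: algebra_simps scaleR_2)
  also have "\<dots> = of_int (link (i + 1) * link i - 2) *\<^sub>R beta i"
    unfolding beta_recurrence by (simp add: scaleR_diff_left)
  also have "link (i + 1) * link i = a * b" by (simp add: link_def)
  finally show ?thesis by (simp add: algebra_simps)
qed

text \<open>Since \<open>ab - 2 \<ge> 2\<close>, the recurrence with step \<open>2\<close> makes the determinants convex along each parity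
  class, and they start with a positive increment.\<close>

lemma area_beta_growth:
  fixes i :: int and n :: nat
  assumes "n \<ge> 1"
  shows "area (beta i) (beta (i + n)) \<ge> 1 \<and>
    area (beta i) (beta (i + n + 2)) \<ge> area (beta i) (beta (i + n)) + 1"
proof -
  let ?f = "\<lambda>n :: int. area (beta i) (beta (i + n))"
  define x where "x = real_of_int (a * b - 2)"
  have rec: "?f (n + 2) = x * ?f n - ?f (n - 2)" for n
  proof -
    have "beta (i + (n + 2)) = of_int (a * b - 2) *\<^sub>R beta (i + n) - beta (i + (n - 2))"
      using beta_step2_recurrence[of "i + n"] by (simp add: add.assoc add_diff_eq)
    then show ?thesis by (simp add: area_linear x_def)
  qed
  have x: "x \<ge> 2" unfolding x_def using ab_ge_4 by linarith
  have f0: "?f 0 = 0" and f1: "?f 1 = 1" and f2: "?f 2 \<ge> 1"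
    using link_pos[of "i + 1"] by (simp_all add: area_linear area_beta_Suc area_beta_step2)
  have "?f (- 1) = - 1"
    using area_beta_Suc[of "i - 1"] area_commute[of "beta i" "beta (i - 1)"] by simp
  then have f3: "?f 3 \<ge> ?f 1 + 1" using rec[of 1] f1 x by simp
  have ge_double: "x * y \<ge> 2 * y" if "y \<ge> 1" for y :: real
    using x that by (intro mult_right_mono) auto
  have "?f 4 = x * ?f 2" using rec[of 2] f0 by simp
  then have f4: "?f 4 \<ge> ?f 2 + 1" using f2 ge_double[OF f2] by linarith
  have "?f n \<ge> 1 \<and> ?f (n + 2) \<ge> ?f n + 1 \<and> ?f (n + 1) \<ge> 1 \<and> ?f (n + 3) \<ge> ?f (n + 1) + 1"
    using assms
  proof (induction n rule: dec_induct)
    case base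
    then show ?case using f1 f2 f3 f4 by simp
  next
    case (step n)
    have "?f (n + 4) \<ge> 2 * ?f (n + 2) - ?f n"
      using rec[of "n + 2"] ge_double[of "?f (n + 2)"] step.IH by (simp add: algebra_simps)
    then show ?case using step.IH by (simp add: algebra_simps)
  qed
  then show ?thesis by (simp add: algebra_simps)
qed

lemma area_beta_ge_2:
  fixes i :: int and d :: nat
  assumes "d \<ge> 3"
  shows "area (beta i) (beta (i + d)) \<ge> 2"
proof -
  have "area (beta i) (beta (i + d)) = area (beta i) (beta (i + int (d - 2) + 2))"
    using assms by (simp add: of_nat_diff)
  moreover have "d - 2 \<ge> 1" using assms by simp
  ultimately show ?thesis using area_beta_growth[of "d - 2" i] by linarith
qed

text \<open>The unit determinant of \<open>\<alpha>\<^sub>1, \<alpha>\<^sub>2\<close> is an integer multiple of that of \<open>u, v\<close>.\<close>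

lemma area_generators:
  assumes "alpha1 \<in> pair_lattice u v" and "alpha2 \<in> pair_lattice u v"
  shows "area u v \<noteq> 0" and "\<bar>area u v\<bar> \<le> 1"
proof -
  obtain m n p q :: int where alpha:
    "alpha1 = of_int m *\<^sub>R u + of_int n *\<^sub>R v" "alpha2 = of_int p *\<^sub>R u + of_int q *\<^sub>R v"
    using assms by (auto simp: pair_lattice_def)
  have "area alpha2 alpha1 = of_int (p * n - q * m) * area u v"
    unfolding alpha using area_commute[of v u] by (simp add: area_linear algebra_simps)
  then have *: "of_int (p * n - q * m) * area u v = 1"
    by (simp add: area_def alpha1_def alpha2_def)
  then show "area u v \<noteq> 0" by auto
  have "p * n - q * m \<noteq> 0" using * by force
  then have "\<bar>real_of_int (p * n - q * m)\<bar> \<ge> 1" by linarith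
  moreover have "\<bar>real_of_int (p * n - q * m)\<bar> * \<bar>area u v\<bar> = 1"
    using * by (metis abs_mult abs_one)
  ultimately show "\<bar>area u v\<bar> \<le> 1"
    by (metis abs_ge_zero mult_right_mono mult_1)
qed

text \<open>The unit determinant leaves \<open>d = 1\<close> and \<open>d = 2\<close>. For \<open>d = 2\<close> it equals the coefficient
  \<open>c(i+1)\<close>, which is then not \<open>a \<ge> 2\<close>, so \<open>i + 1\<close> is even and \<open>b = 1\<close>.\<close>

lemma generating_Phi:
  assumes \<Gamma>: "\<Gamma> \<subseteq> real_roots a b"
    and alpha: "alpha1 \<in> int_span \<Gamma>" "alpha2 \<in> int_span \<Gamma>"
  shows "Phi a b \<Gamma> = real_roots a b \<or> b = 1 \<and> Phi a b \<Gamma> = weyl_orbit a b alpha2"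
proof -
  obtain J where J: "Phi a b \<Gamma> = signed J" "\<And>i j. i \<in> J \<Longrightarrow> j \<in> J \<Longrightarrow> 2 * i - j \<in> J"
    using Phi_eq_signed[OF \<Gamma>] by blast
  have \<Gamma>_J: "\<Gamma> \<subseteq> signed J"
  proof -
    have "bform a b g g \<noteq> 0" if "g \<in> \<Gamma>" for g
      using \<Gamma> that unfolding real_roots_eq_signed
      by (auto elim!: signedE simp: bform_linear bform_beta_nonzero dest!: subsetD)
    then show ?thesis using subset_Phi[of \<Gamma> a b] J(1) by simp
  qed
  have "J \<noteq> {}"
  proof
    assume "J = {}"
    then have "\<Gamma> = {}" using \<Gamma>_J by (simp add: signed_def)
    then show False using alpha(1) by (auto simp: int_span_def alpha1_def zero_prod_def)
  qed
  then obtain i and d :: nat where prog: "J = range (\<lambda>k. i + int d * k)"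
    using point_reflection_closed J(2) by blast
  have "signed J \<subseteq> pair_lattice (beta i) (beta (i + d))"
  proof
    fix v assume "v \<in> signed J"
    then obtain j where j: "j \<in> J" "v = beta j \<or> v = - beta j" by (rule signedE)
    have "beta j \<in> pair_lattice (beta i) (beta (i + d))"
      using j(1) progression_in_lattice unfolding prog by blast
    then show "v \<in> pair_lattice (beta i) (beta (i + d))"
      using j(2) pair_lattice_uminus by metis
  qed
  then have "int_span \<Gamma> \<subseteq> pair_lattice (beta i) (beta (i + d))"
    using \<Gamma>_J by (intro int_span_subset_lattice) blast
  then have area: "area (beta i) (beta (i + d)) \<noteq> 0" "\<bar>area (beta i) (beta (i + d))\<bar> \<le> 1"
    using area_generators alpha by blast+
  have "d < 3" using area_beta_ge_2[of d i] area(2) by linarith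
  moreover have "d \<noteq> 0" using area(1) by (intro notI) (simp add: area_linear(7))
  ultimately consider "d = 1" | "d = 2" by linarith
  then show ?thesis
  proof cases
    case 1
    have "j \<in> J" for j
    proof -
      have "j = i + int d * (j - i)" using 1 by simp
      then show ?thesis unfolding prog by (rule range_eqI)
    qed
    then have "J = UNIV" by blast
    then show ?thesis using J(1) by (simp add: real_roots_eq_signed)
  next
    case 2
    then have "link (i + 1) \<le> 1" using area(2) area_beta_step2[of i] by simp
    then have "b = 1" "odd i" using a_ge_2 b_pos by (auto simp: link_def split: if_splits)
    have J_odd: "J = {j. odd j}"
    proof
      show "J \<subseteq> {j. odd j}" using 2 \<open>odd i\<close> by (auto simp: prog)
      show "{j. odd j} \<subseteq> J"
      proof
        fix j :: int assume "j \<in> {j. odd j}"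
        then have "even (j - i)" using \<open>odd i\<close> by simp
        then obtain k where "j - i = 2 * k" by blast
        then show "j \<in> J" unfolding prog using 2 by (intro range_eqI[where x = k]) simp
      qed
    qed
    have "Phi a b \<Gamma> = weyl_orbit a b alpha2" unfolding J(1) J_odd weyl_orbit_alpha2 ..
    then show ?thesis using \<open>b = 1\<close> by blast
  qed
qed

end

theorem theorem1p2:
  fixes a b :: int and \<Gamma> :: "vec set"
  assumes "a \<ge> b" and "b \<ge> 1" and "a * b \<ge> 4"
    and "\<Gamma> \<subseteq> real_roots a b"
    and "Delta a b \<Gamma> = roots a b"
  shows "(Phi a b \<Gamma> = real_roots a b \<or> Phi a b \<Gamma> = short_roots a b)
    \<and> (Phi a b \<Gamma> = short_roots a b \<longrightarrow>
         (a = 1 \<or> b = 1) \<and> Phi a b \<Gamma> \<subseteq> short_roots a b)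
    \<and> (a = b \<longrightarrow> Delta_re a b \<Gamma> = Phi a b \<Gamma>)"
proof -
  interpret infinite_rank2 a b using assms(1-3) by unfold_locales
  have span: "real_roots a b \<subseteq> int_span \<Gamma>"
    using assms(5) by (auto simp: Delta_def roots_def)
  have alpha: "alpha1 \<in> real_roots a b" "alpha2 \<in> real_roots a b"
    using self_in_weyl_orbit by (auto simp: real_roots_def)
  have cases: "Phi a b \<Gamma> = real_roots a b \<or> b = 1 \<and> Phi a b \<Gamma> = weyl_orbit a b alpha2"
    using generating_Phi[OF assms(4)] alpha span by blast
  have b_less_a: "b < a" if "b = 1" using that a_ge_2 by simp
  have not_short: "real_roots a b \<noteq> short_roots a b"
    using alpha alpha1_not_in_orbit_alpha2 by (auto simp: short_roots_def)
  show ?thesis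
    using cases b_less_a not_short span by (auto simp: short_roots_def Delta_re_def)
qed

end
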